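(* For every natural number $n$, let $a(n)=\sum_{d\mid n,\ 1\le d\le\sqrt{n}} d$, the sum of the positive divisors of $n$ not exceeding $\sqrt{n}$. Then $a(n)$ is of average order $\sqrt{n}$; more precisely, $$\sum_{k=1}^n a(k)=\frac23 n\sqrt{n} + O(n\ln n)\quad\text{as } n\to\infty.$$
   Context: An arithmetic function $f(n)$ is said to be of average order $g(n)$ if $\sum_{k=1}^n f(k)\sim\sum_{k=1}^n g(k)$ as $n\to\infty$, where $F\sim G$ means $\lim F/G=1$. The notation $F(n)=O(G(n))$ means $|F(n)|\le C|G(n)|$ for some constant $C>0$ independent of $n$, for all sufficiently large $n$. *)

theory Defs
  imports Complex_Main "HOL-Library.Landau_Symbols"
begin

definition has_average_order :: "(nat \<Rightarrow> real) \<Rightarrow> (nat \<Rightarrow> real) \<Rightarrow> bool" where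
  "has_average_order f g \<longleftrightarrow> (\<lambda>n. \<Sum>k=1..n. f k) \<sim>[at_top] (\<lambda>n. \<Sum>k=1..n. g k)"

definition small_divisor_sum :: "nat \<Rightarrow> nat" where
  "small_divisor_sum n = (\<Sum>d | d dvd n \<and> 1 \<le> d \<and> real d \<le> sqrt (real n). d)"

end

theory Submission
  imports Defs "HOL-Library.Discrete_Functions" "HOL-Real_Asymp.Real_Asymp"
begin

text \<open>
  Exchanging the order of summation, a divisor \<open>d \<le> \<surd>n\<close> contributes \<open>d\<close> once for each of its
  multiples \<open>k = d q \<le> n\<close> with \<open>q \<ge> d\<close>, that is \<open>d (\<lfloor>n/d\<rfloor> + 1 - d)\<close> in total. Since
  \<open>d \<lfloor>n/d\<rfloor> = n - n mod d\<close>, with \<open>m = \<lfloor>\<surd>n\<rfloor>\<close> the sum is \<open>m n - m\<^sup>3/3 + O(n)\<close>. The function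
  \<open>x \<mapsto> x n - x\<^sup>3/3\<close> is stationary at \<open>x = \<surd>n\<close>, so replacing \<open>m\<close> by \<open>\<surd>n\<close> costs only \<open>O(\<surd>n)\<close> and
  gives \<open>2/3 n\<surd>n\<close>. The error is thus even \<open>O(n)\<close>.
\<close>

lemma mono_antiderivative_increment_bounds:
  fixes f F :: "real \<Rightarrow> real"
  assumes "a < b"
    and mono: "mono_on {a..b} f"
    and cont: "continuous_on {a..b} F"
    and deriv: "\<And>x. a < x \<Longrightarrow> x < b \<Longrightarrow> (F has_real_derivative f x) (at x)"
  shows "(b - a) * f a \<le> F b - F a" "F b - F a \<le> (b - a) * f b"
proof -
  have "F differentiable at x" if "a < x" "x < b" for x
    using deriv[OF that] by (auto simp: real_differentiable_def)
  then obtain l z where a_z_b: "a < z" "z < b"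
    and deriv_z: "(F has_real_derivative l) (at z)" and "F b - F a = (b - a) * l"
    using MVT[OF \<open>a < b\<close> cont] by blast
  moreover have "l = f z"
    using DERIV_unique[OF deriv_z deriv[OF a_z_b]] .
  moreover have "f a \<le> f z" "f z \<le> f b"
    using a_z_b by (auto intro!: mono_onD[OF mono])
  ultimately show "(b - a) * f a \<le> F b - F a" "F b - F a \<le> (b - a) * f b"
    using \<open>a < b\<close> by auto
qed

lemma sum_mono_antiderivative_bounds:
  fixes f F :: "real \<Rightarrow> real" and m n :: nat
  assumes "m \<le> n"
    and mono: "mono_on {real m..real n} f"
    and cont: "continuous_on {real m..real n} F"
    and deriv: "\<And>x. real m < x \<Longrightarrow> x < real n \<Longrightarrow> (F has_real_derivative f x) (at x)"
  shows "F n - F m \<le> (\<Sum>k=Suc m..n. f k)" (is ?lower)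
    and "(\<Sum>k=Suc m..n. f k) \<le> F n - F m + f n - f m" (is ?upper)
proof -
  have increment: "f k \<le> F (Suc k) - F k" "F (Suc k) - F k \<le> f (Suc k)"
    if "k \<in> {m..<n}" for k
  proof -
    have subset: "{real k..real (Suc k)} \<subseteq> {real m..real n}"
      using that by auto
    show "f k \<le> F (Suc k) - F k" "F (Suc k) - F k \<le> f (Suc k)"
      using mono_antiderivative_increment_bounds[OF _ mono_on_subset[OF mono subset]
          continuous_on_subset[OF cont subset] deriv] that by auto
  qed
  have telescope: "(\<Sum>k=m..<n. g (Suc k) - g k) = g n - g m" for g :: "nat \<Rightarrow> real"
    using \<open>m \<le> n\<close> by (rule sum_Suc_diff')
  have shift: "(\<Sum>k=Suc m..n. f k) = (\<Sum>k=m..<n. f (Suc k))"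
    unfolding atLeastLessThanSuc_atLeastAtMost[symmetric] by (rule sum.shift_bounds_Suc_ivl)
  have "F n - F m = (\<Sum>k=m..<n. F (Suc k) - F k)"
    by (rule telescope[symmetric])
  also have "\<dots> \<le> (\<Sum>k=m..<n. f (Suc k))"
    using increment(2) by (rule sum_mono)
  finally show ?lower
    unfolding shift .
  have "(\<Sum>k=m..<n. f (Suc k)) = (\<Sum>k=m..<n. f k) + (f n - f m)"
    using telescope[of "\<lambda>k. f k"] by (simp add: sum_subtractf)
  also have "\<dots> \<le> (\<Sum>k=m..<n. F (Suc k) - F k) + (f n - f m)"
    using increment(1) by (intro add_right_mono sum_mono)
  also have "\<dots> = F n - F m + f n - f m"
    using telescope[of "\<lambda>k. F k"] by simp
  finally show ?upper
    unfolding shift .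
qed

lemma sum_powr_bounds:
  fixes a :: real and n :: nat
  assumes "a \<ge> 0"
  shows "real n powr (a + 1) / (a + 1) \<le> (\<Sum>k=1..n. real k powr a)"
    and "(\<Sum>k=1..n. real k powr a) \<le> real n powr (a + 1) / (a + 1) + real n powr a"
proof -
  let ?F = "\<lambda>x. x powr (a + 1) / (a + 1)"
  have mono: "mono_on {real 0..real n} (\<lambda>x. x powr a)"
    using assms by (intro mono_onI powr_mono2) auto
  have cont: "continuous_on {real 0..real n} ?F"
    using assms by (intro continuous_intros continuous_on_powr') auto
  have deriv: "(?F has_real_derivative x powr a) (at x)" if "real 0 < x" for x
    using that assms by (auto intro!: derivative_eq_intros)
  show "real n powr (a + 1) / (a + 1) \<le> (\<Sum>k=1..n. real k powr a)"
    and "(\<Sum>k=1..n. real k powr a) \<le> real n powr (a + 1) / (a + 1) + real n powr a"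
    using sum_mono_antiderivative_bounds[OF _ mono cont deriv] by simp_all
qed

lemma card_multiples_atLeastAtMost:
  fixes c d n :: nat
  assumes "d > 0"
  shows "card {k \<in> {d * c..n}. d dvd k} = n div d + 1 - c"
proof -
  have "{k \<in> {d * c..n}. d dvd k} = (*) d ` {c..n div d}"
    using assms by (auto simp: less_eq_div_iff_mult_less_eq mult.commute elim!: dvdE)
  moreover have "inj_on ((*) d) {c..n div d}"
    using assms by (auto simp: inj_on_def)
  ultimately show ?thesis
    by (simp add: card_image)
qed

lemma sum_sum_divisors_le_sqrt:
  fixes g :: "nat \<Rightarrow> 'a::semiring_1"
  shows "(\<Sum>k=1..n. \<Sum>d | d dvd k \<and> d\<^sup>2 \<le> k. g d)
    = (\<Sum>d=1..floor_sqrt n. of_nat (n div d + 1 - d) * g d)"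
proof -
  have "(\<Sum>k=1..n. \<Sum>d | d dvd k \<and> d\<^sup>2 \<le> k. g d)
      = (\<Sum>k=1..n. \<Sum>d | d \<in> {1..floor_sqrt n} \<and> (d dvd k \<and> d\<^sup>2 \<le> k). g d)"
    by (intro sum.cong) (auto simp: le_floor_sqrt_iff Suc_le_eq intro: Nat.gr0I)
  also have "\<dots> = (\<Sum>d=1..floor_sqrt n. \<Sum>k | k \<in> {1..n} \<and> (d dvd k \<and> d\<^sup>2 \<le> k). g d)"
    by (rule sum.swap_restrict) auto
  also have "\<dots> = (\<Sum>d=1..floor_sqrt n. of_nat (n div d + 1 - d) * g d)"
  proof (intro sum.cong refl)
    fix d assume "d \<in> {1..floor_sqrt n}"
    then have "d > 0" by simp
    then have "{k. k \<in> {1..n} \<and> (d dvd k \<and> d\<^sup>2 \<le> k)} = {k \<in> {d * d..n}. d dvd k}"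
      by (auto simp: power2_eq_square Suc_le_eq intro: Nat.gr0I)
    then show "(\<Sum>k | k \<in> {1..n} \<and> (d dvd k \<and> d\<^sup>2 \<le> k). g d) = of_nat (n div d + 1 - d) * g d"
      using card_multiples_atLeastAtMost[OF \<open>d > 0\<close>, of d n] by simp
  qed
  finally show ?thesis .
qed

lemma real_small_divisor_sum:
  assumes "k > 0"
  shows "real (small_divisor_sum k) = (\<Sum>d | d dvd k \<and> d\<^sup>2 \<le> k. real d)"
proof -
  have "real d \<le> sqrt (real k) \<longleftrightarrow> d\<^sup>2 \<le> k" for d
    by (metis abs_of_nat of_nat_le_iff of_nat_power real_sqrt_abs real_sqrt_le_iff)
  then show ?thesis
    using assms unfolding small_divisor_sum_def of_nat_sum
    by (intro sum.cong) (auto simp: Suc_le_eq intro: Nat.gr0I)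
qed

lemma sum_small_divisor_sum:
  "(\<Sum>k=1..n. real (small_divisor_sum k))
    = (\<Sum>d=1..floor_sqrt n. real n - (real d)\<^sup>2 + (real d - real (n mod d)))"
proof -
  have "(\<Sum>k=1..n. real (small_divisor_sum k))
      = (\<Sum>k=1..n. \<Sum>d | d dvd k \<and> d\<^sup>2 \<le> k. real d)"
    by (intro sum.cong) (simp_all add: real_small_divisor_sum)
  also have "\<dots> = (\<Sum>d=1..floor_sqrt n. real (n div d + 1 - d) * real d)"
    by (rule sum_sum_divisors_le_sqrt)
  also have "\<dots> = (\<Sum>d=1..floor_sqrt n. real n - (real d)\<^sup>2 + (real d - real (n mod d)))"
  proof (intro sum.cong refl)
    fix d assume "d \<in> {1..floor_sqrt n}"
    then have "d \<le> n div d"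
      by (simp add: le_floor_sqrt_iff less_eq_div_iff_mult_less_eq power2_eq_square)
    then have "real (n div d + 1 - d) = real (n div d) + 1 - real d"
      by linarith
    moreover have "real n = real (n div d) * real d + real (n mod d)"
      by (simp flip: of_nat_mult of_nat_add)
    ultimately show "real (n div d + 1 - d) * real d
        = real n - (real d)\<^sup>2 + (real d - real (n mod d))"
      by (simp add: algebra_simps power2_eq_square)
  qed
  finally show ?thesis .
qed

lemma sum_small_divisor_sum_floor_sqrt_approx:
  fixes n :: nat
  defines "m \<equiv> real (floor_sqrt n)"
  shows "\<bar>(\<Sum>k=1..n. real (small_divisor_sum k)) - (m * real n - m ^ 3 / 3)\<bar> \<le> m\<^sup>2"
proof -
  define Q where "Q = (\<Sum>d=1..floor_sqrt n. (real d)\<^sup>2)"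
  define R where "R = (\<Sum>d=1..floor_sqrt n. real d - real (n mod d))"
  have "(\<Sum>k=1..n. real (small_divisor_sum k)) = m * real n - Q + R"
    unfolding sum_small_divisor_sum Q_def R_def m_def by (simp add: sum.distrib sum_subtractf)
  moreover have "m ^ 3 / 3 \<le> Q" "Q \<le> m ^ 3 / 3 + m\<^sup>2"
    using sum_powr_bounds[of 2 "floor_sqrt n"] by (simp_all add: Q_def m_def)
  moreover have "0 \<le> R"
    unfolding R_def by (intro sum_nonneg) (simp add: less_imp_le)
  moreover have "R \<le> m\<^sup>2"
    using sum_bounded_above[of "{1..floor_sqrt n}" "\<lambda>d. real d - real (n mod d)" m]
    by (simp add: R_def m_def power2_eq_square)
  ultimately show ?thesis by linarith
qed

lemma cubic_approx_near_maximum: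
  fixes x s :: real
  assumes "0 \<le> x" "x \<le> s" "s \<le> x + 1"
  shows "\<bar>(x * s\<^sup>2 - x ^ 3 / 3) - 2 / 3 * s ^ 3\<bar> \<le> s"
proof -
  have "2 / 3 * s ^ 3 - (x * s\<^sup>2 - x ^ 3 / 3) = (s - x)\<^sup>2 * (2 * s + x) / 3"
    by (simp add: field_simps power2_eq_square power3_eq_cube)
  moreover have "(s - x)\<^sup>2 * (2 * s + x) \<le> 1 * (3 * s)"
    using assms by (intro mult_mono) (auto simp: power_le_one)
  moreover have "0 \<le> (s - x)\<^sup>2 * (2 * s + x)"
    using assms by simp
  ultimately show ?thesis by linarith
qed

lemma floor_sqrt_bounds_sqrt:
  "real (floor_sqrt n) \<le> sqrt (real n)" "sqrt (real n) < real (floor_sqrt n) + 1"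
proof -
  have "(real (floor_sqrt n))\<^sup>2 \<le> real n"
    by (simp flip: of_nat_power)
  then show "real (floor_sqrt n) \<le> sqrt (real n)"
    by (rule real_le_rsqrt)
  have "real n < real ((Suc (floor_sqrt n))\<^sup>2)"
    using Suc_floor_sqrt_power2_gt by (simp only: of_nat_less_iff)
  then show "sqrt (real n) < real (floor_sqrt n) + 1"
    by (intro real_less_lsqrt) (auto simp: add_ac)
qed

lemma sum_small_divisor_sum_error_bound:
  "\<bar>(\<Sum>k=1..n. real (small_divisor_sum k)) - 2 / 3 * real n * sqrt (real n)\<bar> \<le> 2 * real n"
proof -
  define s where "s = sqrt (real n)"
  define m where "m = real (floor_sqrt n)"
  have s2: "s\<^sup>2 = real n"
    by (simp add: s_def)
  have "\<bar>(\<Sum>k=1..n. real (small_divisor_sum k)) - (m * s\<^sup>2 - m ^ 3 / 3)\<bar> \<le> m\<^sup>2"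
    using sum_small_divisor_sum_floor_sqrt_approx by (simp add: m_def s2)
  moreover have "\<bar>(m * s\<^sup>2 - m ^ 3 / 3) - 2 / 3 * s ^ 3\<bar> \<le> s"
    using floor_sqrt_bounds_sqrt[of n] by (intro cubic_approx_near_maximum) (auto simp: m_def s_def)
  moreover have "m\<^sup>2 \<le> real n"
    by (simp add: m_def flip: of_nat_power)
  moreover have "n \<le> n\<^sup>2"
    by (simp add: power2_eq_square)
  then have "s \<le> real n"
    unfolding s_def by (intro real_le_lsqrt) simp_all
  moreover have "2 / 3 * real n * s = 2 / 3 * s ^ 3"
    by (simp add: power3_eq_cube power2_eq_square flip: s2)
  ultimately show ?thesis
    unfolding s_def[symmetric] by linarith
qed

lemma sum_sqrt_error_bound:
  "\<bar>(\<Sum>k=1..n. sqrt (real k)) - 2 / 3 * real n * sqrt (real n)\<bar> \<le> sqrt (real n)"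
proof -
  have "real n powr (1 / 2 + 1) = real n * sqrt (real n)"
    by (simp only: powr_add) (simp add: powr_half_sqrt)
  then show ?thesis
    using sum_powr_bounds[of "1 / 2" n] by (simp add: powr_half_sqrt abs_le_iff)
qed

theorem theorem2p1:
  shows "has_average_order (\<lambda>n. real (small_divisor_sum n)) (\<lambda>n. sqrt (real n)) \<and>
    (\<lambda>n::nat. (\<Sum>k=1..n. real (small_divisor_sum k)) - 2 / 3 * real n * sqrt (real n))
      \<in> O[at_top](\<lambda>n. real n * ln (real n))"
proof -
  define main where "main = (\<lambda>n::nat. 2 / 3 * real n * sqrt (real n))"
  define S where "S = (\<lambda>n. \<Sum>k=1..n. real (small_divisor_sum k))"
  define R where "R = (\<lambda>n. \<Sum>k=1..n. sqrt (real k))"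
  have S_error: "(\<lambda>n. S n - main n) \<in> O(\<lambda>n. real n)"
    using sum_small_divisor_sum_error_bound by (intro bigoI[of _ 2]) (simp add: S_def main_def)
  have R_error: "(\<lambda>n. R n - main n) \<in> O(\<lambda>n. sqrt (real n))"
    using sum_sqrt_error_bound by (intro bigoI[of _ 1]) (simp add: R_def main_def)
  have "(\<lambda>n. real n) \<in> o(main)" "(\<lambda>n. sqrt (real n)) \<in> o(main)"
    unfolding main_def by real_asymp+
  then have "S \<sim>[at_top] main" "R \<sim>[at_top] main"
    using S_error R_error by (auto intro: smallo_imp_asymp_equiv landau_o.big_small_trans)
  then have "has_average_order (\<lambda>n. real (small_divisor_sum n)) (\<lambda>n. sqrt (real n))"
    unfolding has_average_order_def S_def R_def by (metis asymp_equiv_sym asymp_equiv_trans)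
  moreover have "(\<lambda>n::nat. real n) \<in> O(\<lambda>n. real n * ln (real n))"
    by real_asymp
  then have "(\<lambda>n. S n - main n) \<in> O(\<lambda>n. real n * ln (real n))"
    by (rule landau_o.big_trans[OF S_error])
  ultimately show ?thesis
    by (simp add: S_def main_def)
qed

end
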